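(* If $\mathcal{A}$ is a deterministic fire-and-forward protocol for information gathering in trees, then the running time of $\mathcal{A}$ is $\Omega(n^{1.5})$. Here the running time $T(n)$ is the minimum time such that for every rooted tree with $n$ nodes, every assignment of distinct labels from $\{0,1,\dots,n-1\}$ to its nodes, and every node $v$, the rumor of $v$ is delivered to the root no later than at step $T(n)$.
   Context: Model. The network is a rooted tree $\mathcal{T}$ with $n$ nodes and root $r$, all edges directed from child to parent. Nodes carry distinct labels from $[n]=\{0,1,\dots,n-1\}$. Each node $v$ initially holds a rumor $\rho_v$. Time is discrete, with steps $0,1,2,\dots$, and all nodes start at step $0$. If $v$ transmits at step $t$, the message is sent immediately to its parent $u$, and $u$ receives it at step $t$ if and only if no other child of $u$ transmits at step $t$ (otherwise a collision occurs, nothing is received, and nobody is informed of the collision). In this fire-and-forward model a node is allowed to receive and transmit in the same step. A deterministic protocol determines the action of each node $v$ at each step $t$ as a function only of $n$, the label of $v$, the time $t$, and the messages received by $v$ before step $t$; it knows neither the tree nor the assignment of labels. Fire-and-forward protocol: at any step $t$, a node $v$ is either idle or makes one of two types of transmission: it fires, i.e. transmits its own rumor $\rho_v$; or it forwards, i.e. transmits the rumor it received in step $t-1$ (if any). A received rumor that is not forwarded in the next step is dropped (a node may drop a received rumor even if it does not fire). If a node attempts to fire at step $t$ right after receiving a rumor at step $t-1$, this counts as a collision and nothing is transmitted. A protocol for information gathering must deliver every rumor to the root, for every tree and every assignment of labels. *)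

theory Defs
  imports Complex_Main "HOL-Library.FuncSet" "HOL-Library.Landau_Symbols"
begin

text \<open>
  The nodes of an \<open>n\<close>-node tree are the numbers below \<open>n\<close>; labels are a separate bijection from
  the nodes onto \<open>{..<n}\<close>. The value of the parent map at the root is irrelevant.
\<close>

definition rooted_tree :: "nat \<Rightarrow> nat \<Rightarrow> (nat \<Rightarrow> nat) \<Rightarrow> bool" where
  "rooted_tree n r par \<longleftrightarrow>
     r < n \<and> (\<forall>v<n. v \<noteq> r \<longrightarrow> par v < n) \<and> (\<forall>v<n. \<exists>k. (par ^^ k) v = r)"

definition children :: "nat \<Rightarrow> nat \<Rightarrow> (nat \<Rightarrow> nat) \<Rightarrow> nat \<Rightarrow> nat set" where
  "children n r par u = {w. w < n \<and> w \<noteq> r \<and> par w = u}"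

definition labeling :: "nat \<Rightarrow> (nat \<Rightarrow> nat) \<Rightarrow> bool" where
  "labeling n lab \<longleftrightarrow> bij_betw lab {..<n} {..<n}"

datatype action = Idle | Fire | Forward

text \<open>
  A rumor is represented by the label of its originator, so rumors are pairwise distinct
  and a protocol may let its actions depend on the origins of the rumors received.
\<close>

type_synonym rumor = nat

text \<open>
  \<open>P n l t h\<close> is the action at step \<open>t\<close> of the node with label \<open>l\<close>. The history \<open>h\<close> has
  length \<open>t\<close>; its entry \<open>s\<close> is what the node received at step \<open>s\<close>. Silence and collision
  are both recorded as \<open>None\<close>.
\<close>

type_synonym protocol = "nat \<Rightarrow> nat \<Rightarrow> nat \<Rightarrow> rumor option list \<Rightarrow> action"

definition previous :: "rumor option list \<Rightarrow> rumor option" where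
  "previous h = (if h = [] then None else last h)"

definition transmission ::
    "protocol \<Rightarrow> nat \<Rightarrow> nat \<Rightarrow> nat \<Rightarrow> rumor option list \<Rightarrow> rumor option" where
  "transmission P n l t h =
     (case P n l t h of
        Idle \<Rightarrow> None
      | Fire \<Rightarrow> (if previous h = None then Some l else None)
      | Forward \<Rightarrow> previous h)"

definition reception :: "nat set \<Rightarrow> (nat \<Rightarrow> rumor option) \<Rightarrow> rumor option" where
  "reception C tx =
     (if \<exists>!w. w \<in> C \<and> tx w \<noteq> None then tx (THE w. w \<in> C \<and> tx w \<noteq> None) else None)"

primrec history ::
    "protocol \<Rightarrow> nat \<Rightarrow> nat \<Rightarrow> (nat \<Rightarrow> nat) \<Rightarrow> (nat \<Rightarrow> nat) \<Rightarrow> nat \<Rightarrow> nat \<Rightarrow> rumor option list"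
where
  "history P n r par lab 0 = (\<lambda>u. [])"
| "history P n r par lab (Suc t) =
     (\<lambda>u. history P n r par lab t u @
        [reception (children n r par u)
           (\<lambda>w. transmission P n (lab w) t (history P n r par lab t w))])"

definition received ::
    "protocol \<Rightarrow> nat \<Rightarrow> nat \<Rightarrow> (nat \<Rightarrow> nat) \<Rightarrow> (nat \<Rightarrow> nat) \<Rightarrow> nat \<Rightarrow> nat \<Rightarrow> rumor option" where
  "received P n r par lab t u =
     reception (children n r par u)
       (\<lambda>w. transmission P n (lab w) t (history P n r par lab t w))"

text \<open>The root holds its own rumor from the start.\<close>

definition delivered_by ::
    "protocol \<Rightarrow> nat \<Rightarrow> nat \<Rightarrow> (nat \<Rightarrow> nat) \<Rightarrow> (nat \<Rightarrow> nat) \<Rightarrow> nat \<Rightarrow> nat \<Rightarrow> bool" where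
  "delivered_by P n r par lab v T \<longleftrightarrow>
     v = r \<or> (\<exists>t\<le>T. received P n r par lab t r = Some (lab v))"

definition gathering_protocol :: "protocol \<Rightarrow> bool" where
  "gathering_protocol P \<longleftrightarrow>
     (\<forall>n r par lab. rooted_tree n r par \<longrightarrow> labeling n lab \<longrightarrow>
        (\<forall>v<n. \<exists>T. delivered_by P n r par lab v T))"

definition completes_by :: "protocol \<Rightarrow> nat \<Rightarrow> nat \<Rightarrow> bool" where
  "completes_by P n T \<longleftrightarrow>
     (\<forall>r par lab. rooted_tree n r par \<longrightarrow> labeling n lab \<longrightarrow>
        (\<forall>v<n. delivered_by P n r par lab v T))"

text \<open>
  For a gathering protocol the minimum exists: there are finitely many labeled trees on
  \<open>n\<close> nodes (shown in \<open>completes_by_running_time\<close> below).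
\<close>

definition running_time :: "protocol \<Rightarrow> nat \<Rightarrow> nat" where
  "running_time P n = (LEAST T. completes_by P n T)"

lemma history_cong:
  assumes p: "\<And>v. v < n \<Longrightarrow> v \<noteq> r \<Longrightarrow> par v = par' v" and l: "\<And>v. v < n \<Longrightarrow> lab v = lab' v"
  shows "history P n r par lab t = history P n r par' lab' t"
proof (induction t)
  case (Suc t)
  have "children n r par = children n r par'"
    using p by (auto simp: children_def fun_eq_iff)
  moreover have "reception (children n r par' u) (\<lambda>w. transmission P n (lab w) t (h w)) =
    reception (children n r par' u) (\<lambda>w. transmission P n (lab' w) t (h w))" for u h
  proof -
    have eq: "w \<in> children n r par' u \<and> transmission P n (lab w) t (h w) \<noteq> None \<longleftrightarrow>
      w \<in> children n r par' u \<and> transmission P n (lab' w) t (h w) \<noteq> None" for w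
      using l by (auto simp: children_def)
    have "(THE w. w \<in> children n r par' u \<and> transmission P n (lab' w) t (h w) \<noteq> None) < n"
      if "\<exists>!w. w \<in> children n r par' u \<and> transmission P n (lab' w) t (h w) \<noteq> None"
      using theI'[OF that] by (simp add: children_def)
    then show ?thesis
      unfolding reception_def eq using l by presburger
  qed
  ultimately show ?case using Suc.IH by simp
qed simp

lemma received_conv_history:
  "received P n r par lab t u = last (history P n r par lab (Suc t) u)"
  by (simp add: received_def)

lemma completes_by_running_time:
  assumes "gathering_protocol P"
  shows "completes_by P n (running_time P n)"
proof -
  define X where "X = {..<n} \<times> ({..<n} \<rightarrow>\<^sub>E {..n}) \<times> ({..<n} \<rightarrow>\<^sub>E {..<n}) \<times> {..<n}"
  define D where "D T = (\<lambda>(r, par, lab, v). delivered_by P n r par lab v T)" for T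
  define B where "B x = (LEAST T. D T x)" for x
  have finX: "finite X"
    unfolding X_def by (intro finite_cartesian_product finite_PiE) auto
  have "completes_by P n (Max (B ` X))"
    unfolding completes_by_def
  proof (intro allI impI)
    fix r par lab v
    assume tr: "rooted_tree n r par" and la: "labeling n lab" and v: "v < n"
    define par' where "par' = (\<lambda>v\<in>{..<n}. if v = r then n else par v)"
    define lab' where "lab' = restrict lab {..<n}"
    have "history P n r par lab t = history P n r par' lab' t" for t
      by (rule history_cong) (auto simp: par'_def lab'_def)
    then have eq: "delivered_by P n r par lab v T = delivered_by P n r par' lab' v T" for T
      using v by (simp add: delivered_by_def received_conv_history lab'_def del: history.simps)
    have x: "(r, par', lab', v) \<in> X"
      using tr la v unfolding X_def par'_def lab'_def rooted_tree_def labeling_def bij_betw_def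
      by (auto simp: less_imp_le)
    obtain T where "delivered_by P n r par lab v T"
      using assms tr la v unfolding gathering_protocol_def by blast
    then have "D T (r, par', lab', v)" by (simp add: D_def eq)
    then have "D (B (r, par', lab', v)) (r, par', lab', v)"
      unfolding B_def by (rule LeastI)
    then have "delivered_by P n r par lab v (B (r, par', lab', v))"
      by (simp add: D_def eq)
    moreover have "B (r, par', lab', v) \<le> Max (B ` X)"
      using finX x by simp
    ultimately show "delivered_by P n r par lab v (Max (B ` X))"
      unfolding delivered_by_def by (meson order_trans)
  qed
  then show ?thesis unfolding running_time_def by (rule LeastI)
qed

end

theory Submission
  imports Defs
begin

text \<open>
  The trees are caterpillars: a path (the spine) ending in the root, with one victim leaf at its far
  end and all other leaves distributed along the spine. A leaf never receives anything, so the set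
  of times at which it fires depends only on its label. A rumor fired by the victim at time \<open>t\<close>
  can move only one spine node per step, and it is lost if a leaf attached \<open>\<sigma>\<close> nodes further up
  fires at time \<open>t + \<sigma>\<close>. It remains to find a victim label and positions for the
  other labels such that every firing of the victim up to time \<open>T\<close> is lost, when \<open>T\<close> is at most
  a small multiple of \<open>n powr (3/2)\<close>.

  Put every other label at a random position, except that with probability \<open>1/2\<close> it is kept in
  reserve, and let \<open>q\<close> be about \<open>sqrt n\<close>. If fewer than \<open>q\<close> firings of the victim survive and each
  of them is followed within one spine length by firings of at least \<open>q\<close> reserved labels, then
  distinct reserved labels can be used to block the survivors. A label can fail to be a victim for
  two reasons: few other labels fire shortly after one of its firings, or the expected number of
  survivors is large. Cutting time into blocks of spine length shows that the number of labels of
  either kind is of order \<open>T * q / n + T / q\<close> at most, up to lower-order terms.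
\<close>

section \<open>Derandomization and elementary sum bounds\<close>

text \<open>Method of conditional expectations: the right-hand side is the expectation of the
  left-hand side for independent uniform choices from \<open>C\<close>. In the induction the
  averaged factor of \<open>x\<close> is absorbed into the weights \<open>w\<close>, the other
  choices are fixed, and \<open>x\<close> then gets a value that does no worse than the
  average.\<close>

lemma exists_le_average:
  fixes w :: "'i \<Rightarrow> real" and g :: "'i \<Rightarrow> 'l \<Rightarrow> 'c \<Rightarrow> real"
  assumes "finite L" "finite C" "C \<noteq> {}"
  shows "\<exists>a. (\<Sum>i\<in>I. w i * (\<Prod>l\<in>L. g i l (a l))) \<le>
    (\<Sum>i\<in>I. w i * (\<Prod>l\<in>L. (\<Sum>c\<in>C. g i l c) / card C))"
  using assms(1)
proof (induction L arbitrary: w rule: finite_induct)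
  case empty
  then show ?case by simp
next
  case (insert x L)
  define v where "v i = w i * ((\<Sum>c\<in>C. g i x c) / card C)" for i
  have C: "card C > 0" using assms(2,3) by (simp add: card_gt_0_iff)
  obtain a where le:
    "(\<Sum>i\<in>I. v i * (\<Prod>l\<in>L. g i l (a l))) \<le>
     (\<Sum>i\<in>I. v i * (\<Prod>l\<in>L. (\<Sum>c\<in>C. g i l c) / card C))"
    using insert.IH by blast
  define S where "S c = (\<Sum>i\<in>I. w i * g i x c * (\<Prod>l\<in>L. g i l (a l)))" for c
  have "(\<Sum>c\<in>C. S c) = (\<Sum>i\<in>I. \<Sum>c\<in>C. w i * g i x c * (\<Prod>l\<in>L. g i l (a l)))"
    unfolding S_def by (rule sum.swap)
  also have "\<dots> = (\<Sum>i\<in>I. card C * (v i * (\<Prod>l\<in>L. g i l (a l))))"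
    unfolding v_def using C by (simp flip: sum_distrib_left sum_distrib_right)
  finally have avg: "(\<Sum>c\<in>C. S c) = card C * (\<Sum>i\<in>I. v i * (\<Prod>l\<in>L. g i l (a l)))"
    by (simp add: sum_distrib_left)
  obtain c where c: "c \<in> C" "S c \<le> (\<Sum>i\<in>I. v i * (\<Prod>l\<in>L. g i l (a l)))"
  proof (rule ccontr)
    assume "\<not> thesis"
    with that have "\<And>c. c \<in> C \<Longrightarrow> (\<Sum>i\<in>I. v i * (\<Prod>l\<in>L. g i l (a l))) < S c"
      by force
    then have "(\<Sum>c\<in>C. (\<Sum>i\<in>I. v i * (\<Prod>l\<in>L. g i l (a l)))) < sum S C"
      using assms(2,3) by (intro sum_strict_mono) auto
    then show False using avg by simp
  qed
  have "(\<Sum>i\<in>I. w i * (\<Prod>l\<in>insert x L. g i l ((a(x := c)) l))) = S c"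
    unfolding S_def using insert.hyps
    by (intro sum.cong refl)
       (auto simp: mult.assoc intro!: prod.cong arg_cong2[where f = "(*)"])
  also have "\<dots> \<le> (\<Sum>i\<in>I. v i * (\<Prod>l\<in>L. (\<Sum>c\<in>C. g i l c) / card C))"
    using c le by linarith
  also have "\<dots> = (\<Sum>i\<in>I. w i * (\<Prod>l\<in>insert x L. (\<Sum>c\<in>C. g i l c) / card C))"
    using insert.hyps by (simp add: v_def mult.assoc)
  finally show ?case by blast
qed

lemma distinct_representatives:
  assumes "finite R" "\<And>t. t \<in> R \<Longrightarrow> card R \<le> card (S t)"
  shows "\<exists>\<phi>. inj_on \<phi> R \<and> (\<forall>t\<in>R. \<phi> t \<in> S t)"
  using assms
proof (induction R rule: finite_induct)
  case (insert x R)
  then obtain \<phi> where \<phi>: "inj_on \<phi> R" "\<forall>t\<in>R. \<phi> t \<in> S t"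
    by (metis card_insert_disjoint insertCI le_SucI Suc_leD)
  have "card (\<phi> ` R) < card (S x)"
    using insert.prems[of x] insert.hyps card_image_le[of R \<phi>] by simp
  then obtain y where "y \<in> S x" "y \<notin> \<phi> ` R"
    by (metis card_mono finite_imageI insert.hyps(1) leD subsetI)
  then show ?case using \<phi> insert.hyps
    by (intro exI[of _ "\<phi>(x := y)"]) (auto simp: inj_on_def)
qed simp

text \<open>For distinct values of \<open>k\<close> the ranks counted from the top are exactly 1 to
  \<open>card S\<close>. Ties only raise the exponents, which lowers the sum because
  \<open>x \<le> 1\<close>. The induction removes a minimal element, whose exponent is
  \<open>card S\<close>.\<close>

lemma sum_power_rank_le:
  fixes x :: real and k :: "'a \<Rightarrow> nat"
  assumes "finite S" "0 \<le> x" "x \<le> 1"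
  shows "(\<Sum>p\<in>S. x ^ card {p'\<in>S. k p \<le> k p'}) \<le> (\<Sum>i=1..card S. x ^ i)"
  using assms(1)
proof (induction "card S" arbitrary: S)
  case (Suc m)
  then have ne: "S \<noteq> {}" by auto
  define p where "p = arg_min_on k S"
  have p: "p \<in> S" "\<And>p'. p' \<in> S \<Longrightarrow> k p \<le> k p'"
    using Suc.prems ne arg_min_if_finite(1)[of S k] arg_min_least[of S _ k]
    unfolding p_def by auto
  have m: "m = card (S - {p})" using Suc p by simp
  have "(\<Sum>p\<in>S. x ^ card {p'\<in>S. k p \<le> k p'}) =
     x ^ card {p'\<in>S. k p \<le> k p'} + (\<Sum>y\<in>S-{p}. x ^ card {p'\<in>S. k y \<le> k p'})"
    using Suc.prems p by (simp add: sum.remove)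
  also have "{p'\<in>S. k p \<le> k p'} = S" using p by auto
  also have "(\<Sum>y\<in>S-{p}. x ^ card {p'\<in>S. k y \<le> k p'}) \<le>
      (\<Sum>y\<in>S-{p}. x ^ card {p'\<in>S-{p}. k y \<le> k p'})"
    using Suc.prems assms by (intro sum_mono power_decreasing card_mono) auto
  also have "\<dots> \<le> (\<Sum>i=1..card (S - {p}). x ^ i)"
    using Suc.hyps(1)[OF m] Suc.prems by simp
  also have "x ^ card S + (\<Sum>i=1..card (S - {p}). x ^ i) = (\<Sum>i=1..card S. x ^ i)"
    using m Suc.hyps(2)[symmetric] by simp
  finally show ?case by simp
qed simp

text \<open>A geometric sum, estimated through \<open>1 + y \<le> exp y\<close>. The term
  \<open>exp (- y) ^ N\<close> is kept in the intermediate bound so that the induction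
  telescopes.\<close>

lemma sum_exp_power_le:
  fixes y :: real
  assumes "y > 0"
  shows "(\<Sum>i=1..N. exp (- y) ^ i) \<le> 1 / y"
proof -
  have "(\<Sum>i=1..N. exp (- y) ^ i) * y \<le> 1 - exp (- y) ^ N"
  proof (induction N)
    case (Suc N)
    have "exp (- y) * (1 + y) \<le> exp (- y) * exp y"
      by (intro mult_left_mono exp_ge_add_one_self) auto
    then have "exp (- y) * y \<le> 1 - exp (- y)"
      by (simp add: algebra_simps flip: exp_add)
    then have "exp (- y) ^ N * (exp (- y) * y) \<le> exp (- y) ^ N * (1 - exp (- y))"
      by (intro mult_left_mono) auto
    with Suc show ?case by (simp add: algebra_simps)
  qed simp
  also have "\<dots> \<le> 1" by simp
  finally show ?thesis using assms by (simp add: field_simps)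
qed

section \<open>Counting bad labels block by block\<close>

text \<open>An element \<open>t + c\<close> stands for a position \<open>c < M\<close> at which
  \<open>l\<close> blocks a firing at time \<open>t\<close>.\<close>

definition window :: "('a \<Rightarrow> nat set) \<Rightarrow> nat \<Rightarrow> nat \<Rightarrow> 'a \<Rightarrow> nat set" where
  "window F M t l = F l \<inter> {t..<t+M}"

lemma finite_window [simp]: "finite (window F M t l)"
  by (simp add: window_def)

lemma card_window_le: "card (window F M t l) \<le> M"
  using card_mono[of "{t..<t+M}" "window F M t l"] by (simp add: window_def)

text \<open>
  The probability that a firing at time \<open>t\<close> survives if each label in \<open>L\<close> is, with probability
  \<open>1/2\<close>, placed at one of \<open>M\<close> positions chosen uniformly.
\<close>

definition weight :: "('a \<Rightarrow> nat set) \<Rightarrow> nat \<Rightarrow> 'a set \<Rightarrow> nat \<Rightarrow> real" where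
  "weight F M L t = (\<Prod>l\<in>L. 1 - card (window F M t l) / (2 * real M))"

text \<open>Bounds the labels with a poorly covered firing. Group them by the block of
  \<open>M\<close> steps containing \<open>\<tau> l\<close>. All labels of a block fire in the
  window of the earliest one, which sees fewer than \<open>k\<close> others, so a block holds at
  most \<open>k\<close> of them.\<close>

lemma card_block_le:
  assumes "\<And>l. l \<in> A \<Longrightarrow> l \<in> L \<and> \<tau> l \<in> F l \<and> \<tau> l \<le> T \<and>
      card {l'\<in>L - {l}. window F M (\<tau> l) l' \<noteq> {}} < k"
    and "finite L" "M > 0"
  shows "card A \<le> (T div M + 1) * k"
proof -
  define B where "B b = {l\<in>A. \<tau> l div M = b}" for b
  have finA: "finite A" using assms(1,2) by (meson finite_subset subsetI)
  have "card (B b) \<le> k" for b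
  proof (cases "B b = {}")
    case False
    define l where "l = arg_min_on \<tau> (B b)"
    have finB: "finite (B b)" using finA by (simp add: B_def)
    have l: "l \<in> B b" "\<And>l'. l' \<in> B b \<Longrightarrow> \<tau> l \<le> \<tau> l'"
      using arg_min_if_finite(1)[OF finB False, of \<tau>] arg_min_least[OF finB False]
      unfolding l_def by auto
    have "\<tau> l' \<in> window F M (\<tau> l) l'" if "l' \<in> B b" for l'
    proof -
      have eq: "\<tau> l' div M = \<tau> l div M" using that l(1) by (simp add: B_def)
      have "\<tau> l' = \<tau> l div M * M + \<tau> l' mod M" using eq by (metis div_mult_mod_eq)
      moreover have "\<tau> l' mod M < M" using assms(3) by simp
      moreover have "\<tau> l div M * M \<le> \<tau> l" by simp
      ultimately have "\<tau> l' < \<tau> l + M" by linarith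
      then show ?thesis using l(2)[OF that] that assms(1) by (auto simp: window_def B_def)
    qed
    then have "B b - {l} \<subseteq> {l'\<in>L - {l}. window F M (\<tau> l) l' \<noteq> {}}"
      using assms(1) by (auto simp: B_def)
    then have "card (B b - {l}) \<le> card {l'\<in>L - {l}. window F M (\<tau> l) l' \<noteq> {}}"
      using assms(2) by (intro card_mono) auto
    then have "card (B b - {l}) < k" using assms(1)[of l] l(1) by (auto simp: B_def)
    then show ?thesis using l(1) by simp
  qed simp
  have "A = (\<Union>b\<le>T div M. B b)"
    using assms(1) by (auto simp: B_def div_le_mono)
  then have "card A \<le> (\<Sum>b\<le>T div M. card (B b))"
    using card_UN_le[of "{..T div M}" B] by simp
  also have "\<dots> \<le> (\<Sum>b\<le>T div M. k)" by (intro sum_mono) (rule \<open>card (B _) \<le> k\<close>)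
  finally show ?thesis by simp
qed

text \<open>Each factor is bounded by \<open>1 - x \<le> exp (- x)\<close>, so survival decays
  exponentially in the total number of firings in the window.\<close>

lemma weight_le:
  assumes "finite L"
  shows "weight F M L t \<le> exp (- 1 / (2 * real M)) ^ (\<Sum>l\<in>L. card (window F M t l))"
proof -
  have "weight F M L t \<le> (\<Prod>l\<in>L. exp (- 1 / (2 * real M)) ^ card (window F M t l))"
    unfolding weight_def
  proof (intro prod_mono conjI)
    fix l
    have "card (window F M t l) \<le> M" by (rule card_window_le)
    then show "0 \<le> 1 - card (window F M t l) / (2 * real M)"
      by (cases "M = 0") (auto simp: field_simps)
    have "1 + (- (card (window F M t l) / (2 * real M))) \<le> exp (- (card (window F M t l) / (2 * real M)))"
      by (rule exp_ge_add_one_self)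
    then show "1 - card (window F M t l) / (2 * real M) \<le> exp (- 1 / (2 * real M)) ^ card (window F M t l)"
      by (simp flip: exp_of_nat_mult)
  qed
  then show ?thesis by (simp add: power_sum)
qed

text \<open>Within a block of \<open>M\<close> steps, the window of a firing covers all
  \<open>j\<close> firings of the block that are not earlier, itself included. Its weight is thus at
  most \<open>exp (- 1 / (2 * M)) ^ j\<close>, and the rank bound turns the sum over the block into
  a geometric sum of size at most \<open>2 * M\<close>.\<close>

lemma sum_weight_le:
  assumes "finite L" "M > 0"
  shows "(\<Sum>l\<in>L. \<Sum>t\<in>F l \<inter> {..T}. weight F M L t) \<le> real (T div M + 1) * (2 * M)"
proof -
  define S where "S = Sigma L (\<lambda>l. F l \<inter> {..T})"
  define x where "x = exp (- 1 / (2 * real M))"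
  have x: "0 \<le> x" "x \<le> 1" using assms(2) by (auto simp: x_def)
  have finS: "finite S" using assms by (auto simp: S_def)
  define B where "B b = {p\<in>S. snd p div M = b}" for b
  have finB: "finite (B b)" for b using finS by (simp add: B_def)
  have block: "(\<Sum>p\<in>B b. weight F M L (snd p)) \<le> 2 * M" for b
  proof -
    have "(\<Sum>p\<in>B b. weight F M L (snd p)) \<le> (\<Sum>p\<in>B b. x ^ card {p'\<in>B b. snd p \<le> snd p'})"
    proof (intro sum_mono)
      fix p assume p: "p \<in> B b"
      have "{p'\<in>B b. snd p \<le> snd p'} \<subseteq> Sigma L (window F M (snd p))"
      proof
        fix p' assume p': "p' \<in> {p'\<in>B b. snd p \<le> snd p'}"
        have eq: "snd p' div M = snd p div M" using p p' by (simp add: B_def)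
        have "snd p' = snd p div M * M + snd p' mod M" using eq by (metis div_mult_mod_eq)
        moreover have "snd p' mod M < M" using assms(2) by simp
        moreover have "snd p div M * M \<le> snd p" by simp
        ultimately have "snd p' < snd p + M" by linarith
        then show "p' \<in> Sigma L (window F M (snd p))"
          using p' by (auto simp: window_def B_def S_def)
      qed
      then have "card {p'\<in>B b. snd p \<le> snd p'} \<le> card (Sigma L (window F M (snd p)))"
        using assms(1) by (intro card_mono) auto
      also have "\<dots> = (\<Sum>l\<in>L. card (window F M (snd p) l))"
        using assms(1) by simp
      finally have "x ^ (\<Sum>l\<in>L. card (window F M (snd p) l)) \<le> x ^ card {p'\<in>B b. snd p \<le> snd p'}"
        using x by (intro power_decreasing) auto
      then show "weight F M L (snd p) \<le> x ^ card {p'\<in>B b. snd p \<le> snd p'}"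
        using weight_le[OF assms(1), of F M "snd p"] by (simp add: x_def)
    qed
    also have "\<dots> \<le> (\<Sum>i=1..card (B b). x ^ i)"
      using finB x by (rule sum_power_rank_le)
    also have "\<dots> \<le> 1 / (1 / (2 * real M))"
      using sum_exp_power_le[of "1 / (2 * real M)" "card (B b)"] assms(2) by (simp add: x_def)
    finally show ?thesis by simp
  qed
  have "(\<Sum>l\<in>L. \<Sum>t\<in>F l \<inter> {..T}. weight F M L t) = (\<Sum>p\<in>S. weight F M L (snd p))"
    using assms(1) by (simp add: S_def sum.Sigma case_prod_unfold)
  also have "\<dots> = (\<Sum>b\<le>T div M. \<Sum>p\<in>B b. weight F M L (snd p))"
    unfolding B_def using finS
    by (intro sum.group[symmetric]) (auto simp: S_def div_le_mono)
  also have "\<dots> \<le> (\<Sum>b\<le>T div M. real (2 * M))"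
    using block by (intro sum_mono) auto
  finally show ?thesis by simp
qed

section \<open>Choosing the victim and the positions\<close>

text \<open>\<open>count\<close> leaves a label that is bad for neither reason; \<open>qT\<close>
  pays for the union bound over the at most \<open>T + 1\<close> firings of that label.\<close>

lemma exists_blocked_label:
  fixes F :: "'a \<Rightarrow> nat set"
  assumes L: "finite L" and M: "M > 0" and q: "q > 0"
    and qT: "2 * (real T + 1) \<le> 2 ^ q"
    and count: "real (T div M + 1) * (5 * real q + 8 * real M / real q) < card L"
  shows "\<exists>l\<in>L. \<exists>\<sigma>. (\<forall>l'. \<sigma> l' < M) \<and>
    (\<forall>t\<in>F l. t \<le> T \<longrightarrow> (\<exists>l'\<in>L - {l}. t + \<sigma> l' \<in> F l'))"
proof -
  define X where "X l = F l \<inter> {..T}" for l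
  \<comment> \<open>The factor 5 is chosen because \<open>(3 / 4) ^ 5 \<le> 1 / 4\<close>: the
    moment bound then shrinks like \<open>(1 / 4) ^ q\<close> and beats the factor
    \<open>2 ^ q\<close> below.\<close>
  define A where "A = {l\<in>L. \<exists>t\<in>X l. card {l'\<in>L - {l}. window F M t l' \<noteq> {}} < 5 * q}"
  \<comment> \<open>The threshold is \<open>q / 4\<close> because removing the victim's own factor,
    which is at least 1/2, can double the weights; fewer than \<open>q / 2\<close> expected
    survivors remain.\<close>
  define B where "B = {l\<in>L. real q / 4 \<le> (\<Sum>t\<in>X l. weight F M L t)}"
  have "\<forall>l\<in>A. \<exists>t. t \<in> X l \<and> card {l'\<in>L - {l}. window F M t l' \<noteq> {}} < 5 * q"
    by (auto simp: A_def)
  then obtain \<tau> where "\<forall>l\<in>A. \<tau> l \<in> X l \<and> card {l'\<in>L - {l}. window F M (\<tau> l) l' \<noteq> {}} < 5 * q"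
    by metis
  then have "card A \<le> (T div M + 1) * (5 * q)"
    using L M by (intro card_block_le[where \<tau> = \<tau> and F = F and L = L]) (auto simp: X_def A_def)
  then have cardA: "real (card A) \<le> real (T div M + 1) * (5 * q)"
    by (metis of_nat_le_iff of_nat_mult)
  have weight_nonneg: "weight F M K t \<ge> 0" for K t
    unfolding weight_def
  proof (intro prod_nonneg)
    fix l
    show "0 \<le> 1 - card (window F M t l) / (2 * real M)"
      using card_window_le[of F M t l] M by (simp add: field_simps)
  qed
  have "card B * (real q / 4) \<le> (\<Sum>l\<in>B. \<Sum>t\<in>X l. weight F M L t)"
    using sum_bounded_below[of B "real q / 4"] by (auto simp: B_def)
  also have "\<dots> \<le> (\<Sum>l\<in>L. \<Sum>t\<in>X l. weight F M L t)"
    using L weight_nonneg by (intro sum_mono2) (auto simp: B_def intro: sum_nonneg)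
  also have "\<dots> \<le> real (T div M + 1) * (2 * M)"
    unfolding X_def using L M by (rule sum_weight_le)
  finally have cardB: "real (card B) \<le> real (T div M + 1) * (8 * M / q)"
    using q by (simp add: field_simps)
  have "real (card (A \<union> B)) \<le> real (card A) + real (card B)"
    using card_Un_le[of A B] by linarith
  also have "\<dots> < card L" using cardA cardB count by (simp add: algebra_simps)
  finally have "A \<union> B \<noteq> L" by auto
  then obtain l where l: "l \<in> L" "l \<notin> A" "l \<notin> B"
    by (auto simp: A_def B_def)
  define L' where "L' = L - {l}"
  have L': "finite L'" using L by (simp add: L'_def)
  have finX: "finite (X l)" by (simp add: X_def)
  have many: "5 * q \<le> card {l'\<in>L'. window F M t l' \<noteq> {}}" if "t \<in> X l" for t
    using l that by (auto simp: A_def L'_def not_less)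
  have weight2: "weight F M L' t \<le> 2 * weight F M L t" for t
  proof -
    have "weight F M L t = (1 - card (window F M t l) / (2 * real M)) * weight F M L' t"
      unfolding weight_def L'_def using L l by (simp add: prod.remove)
    moreover have "1 - card (window F M t l) / (2 * real M) \<ge> 1 / 2"
      using card_window_le[of F M t l] M by (simp add: field_simps)
    ultimately have "weight F M L t \<ge> 1 / 2 * weight F M L' t"
      using weight_nonneg[of L' t] by (metis mult_right_mono)
    then show ?thesis by simp
  qed
  have sumW: "(\<Sum>t\<in>X l. weight F M L' t) < q / 2"
  proof -
    have "(\<Sum>t\<in>X l. weight F M L' t) \<le> 2 * (\<Sum>t\<in>X l. weight F M L t)"
      unfolding sum_distrib_left using weight2 by (intro sum_mono)
    then show ?thesis using l by (simp add: B_def)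
  qed
  \<comment> \<open>A choice \<open>c < M\<close> for a label is its position; the other half of \<open>C\<close> means that it is reserved.\<close>
  define C where "C = {..<2 * M}"
  define gS :: "nat \<Rightarrow> 'a \<Rightarrow> nat \<Rightarrow> real"
    where "gS t l' c = (if c < M \<and> t + c \<in> F l' then 0 else 1)" for t l' c
  define gR :: "nat \<Rightarrow> 'a \<Rightarrow> nat \<Rightarrow> real"
    where "gR t l' c = (if window F M t l' \<noteq> {} \<and> M \<le> c then 1 / 2 else 1)" for t l' c
  have avgS: "(\<Sum>c\<in>C. gS t l' c) / card C = 1 - card (window F M t l') / (2 * real M)" for t l'
  proof -
    define Z where "Z = {c. c < M \<and> t + c \<in> F l'}"
    have Z: "Z \<subseteq> C" using M by (auto simp: Z_def C_def)
    have "window F M t l' = (+) t ` Z"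
      unfolding window_def Z_def
      by (auto simp: image_iff) (metis le_add_diff_inverse less_diff_conv2 add.commute)
    then have cardZ: "card (window F M t l') = card Z" by (simp add: card_image)
    have "(\<Sum>c\<in>C. gS t l' c) = (\<Sum>c\<in>C - Z. gS t l' c) + (\<Sum>c\<in>Z. gS t l' c)"
      by (rule sum.subset_diff[OF Z]) (simp add: C_def)
    also have "(\<Sum>c\<in>C - Z. gS t l' c) = (\<Sum>c\<in>C - Z. 1)"
      by (intro sum.cong) (auto simp: gS_def Z_def)
    also have "(\<Sum>c\<in>Z. gS t l' c) = 0"
      by (simp add: gS_def Z_def)
    also have "(\<Sum>c\<in>C - Z. 1) + 0 = real (2 * M) - card Z"
      using Z card_mono[OF _ Z] finite_subset[OF Z]
      by (simp add: card_Diff_subset C_def of_nat_diff)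
    finally show ?thesis using M by (simp add: cardZ C_def field_simps)
  qed
  \<comment> \<open>The value 3/4 is the mean of 1 (placed) and 1/2 (reserved).\<close>
  have avgR: "(\<Sum>c\<in>C. gR t l' c) / card C = (if window F M t l' \<noteq> {} then 3 / 4 else 1)" for t l'
  proof -
    have "C = {..<M} \<union> {M..<2*M}" by (auto simp: C_def)
    then have "(\<Sum>c\<in>C. gR t l' c) = (\<Sum>c<M. gR t l' c) + (\<Sum>c=M..<2*M. gR t l' c)"
      by (simp only:) (rule sum.union_disjoint; auto)
    also have "(\<Sum>c<M. gR t l' c) = (\<Sum>c<M. 1)"
      by (intro sum.cong) (auto simp: gR_def)
    also have "(\<Sum>c=M..<2*M. gR t l' c) = (\<Sum>c=M..<2*M. if window F M t l' \<noteq> {} then 1 / 2 else 1)"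
      by (intro sum.cong) (auto simp: gR_def)
    finally show ?thesis using M by (simp add: C_def field_simps)
  qed
  \<comment> \<open>The expected number of survivors and \<open>q\<close> times an exponential-moment bound for the number of
    firings with fewer than \<open>q\<close> reserved labels, so that a total below \<open>q\<close> excludes the latter.\<close>
  define I where "I = X l \<times> (UNIV :: bool set)"
  define w :: "nat \<times> bool \<Rightarrow> real" where "w = (\<lambda>(t, b). if b then real q * 2 ^ q else 1)"
  define g where "g = (\<lambda>(t, b). if b then gR t else gS t)"
  have split: "(\<Sum>i\<in>I. w i * (\<Prod>l'\<in>L'. G i l')) =
      (\<Sum>t\<in>X l. \<Prod>l'\<in>L'. G (t, False) l') + (\<Sum>t\<in>X l. real q * 2 ^ q * (\<Prod>l'\<in>L'. G (t, True) l'))"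
    for G :: "nat \<times> bool \<Rightarrow> 'a \<Rightarrow> real"
    unfolding I_def w_def
    by (simp add: sum.cartesian_product' UNIV_bool sum.distrib)
  have "finite C" "C \<noteq> {}" using M by (auto simp: C_def lessThan_empty_iff)
  then obtain a where "(\<Sum>i\<in>I. w i * (\<Prod>l'\<in>L'. g i l' (a l'))) \<le>
      (\<Sum>i\<in>I. w i * (\<Prod>l'\<in>L'. (\<Sum>c\<in>C. g i l' c) / card C))"
    using exists_le_average[OF L', of C w g I] by blast
  then have a: "(\<Sum>t\<in>X l. \<Prod>l'\<in>L'. gS t l' (a l')) + (\<Sum>t\<in>X l. real q * 2 ^ q * (\<Prod>l'\<in>L'. gR t l' (a l')))
      \<le> (\<Sum>t\<in>X l. weight F M L' t) +
         (\<Sum>t\<in>X l. real q * 2 ^ q * (\<Prod>l'\<in>L'. if window F M t l' \<noteq> {} then 3 / 4 else 1))"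
    unfolding split by (simp add: g_def avgS avgR weight_def)
  have "real q * 2 ^ q * (\<Prod>l'\<in>L'. if window F M t l' \<noteq> {} then 3 / 4 else 1) \<le> q / 2 ^ q"
    if "t \<in> X l" for t
  proof -
    have "(\<Prod>l'\<in>L'. if window F M t l' \<noteq> {} then 3 / 4 else 1) =
        (3 / 4 :: real) ^ card {l'\<in>L'. window F M t l' \<noteq> {}}"
      using L' by (simp add: prod.inter_filter[symmetric])
    also have "\<dots> \<le> (3 / 4) ^ (5 * q)" using many[OF that] by (intro power_decreasing) auto
    also have "\<dots> \<le> (1 / 4) ^ q" unfolding power_mult by (intro power_mono) (auto simp: power_divide)
    finally have "real q * 2 ^ q * (\<Prod>l'\<in>L'. if window F M t l' \<noteq> {} then 3 / 4 else 1) \<le>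
        real q * 2 ^ q * (1 / 4 :: real) ^ q"
      by (intro mult_left_mono) auto
    also have "\<dots> = q / 2 ^ q"
      by (simp add: power_divide field_simps flip: power_mult_distrib)
    finally show ?thesis .
  qed
  then have "(\<Sum>t\<in>X l. real q * 2 ^ q * (\<Prod>l'\<in>L'. if window F M t l' \<noteq> {} then 3 / 4 else 1)) \<le>
      (\<Sum>t\<in>X l. q / 2 ^ q)"
    by (intro sum_mono)
  also have "\<dots> \<le> (real T + 1) * (q / 2 ^ q)"
  proof -
    have "card (X l) \<le> T + 1" using card_mono[of "{..T}" "X l"] by (simp add: X_def)
    then have "real (card (X l)) \<le> real T + 1" by linarith
    then show ?thesis unfolding sum_constant by (intro mult_right_mono) auto
  qed
  also have "\<dots> = real q * ((real T + 1) / 2 ^ q)" by simp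
  also have "\<dots> \<le> real q * (1 / 2)"
    using qT by (intro mult_left_mono) (auto simp: field_simps)
  finally have small: "(\<Sum>t\<in>X l. \<Prod>l'\<in>L'. gS t l' (a l')) +
      (\<Sum>t\<in>X l. real q * 2 ^ q * (\<Prod>l'\<in>L'. gR t l' (a l'))) < q"
    using a sumW by linarith
  have gS_nonneg: "(\<Prod>l'\<in>L'. gS t l' (a l')) \<ge> 0" for t
    by (intro prod_nonneg) (auto simp: gS_def)
  have gR_nonneg: "(\<Prod>l'\<in>L'. gR t l' (a l')) \<ge> 0" for t
    by (intro prod_nonneg) (auto simp: gR_def)
  define R where "R = {t\<in>X l. \<forall>l'\<in>L'. \<not> (a l' < M \<and> t + a l' \<in> F l')}"
  have finR: "finite R" using finX by (simp add: R_def)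
  define S where "S t = {l'\<in>L'. window F M t l' \<noteq> {} \<and> M \<le> a l'}" for t
  have "(\<Prod>l'\<in>L'. gS t l' (a l')) = 1" if "t \<in> R" for t
    using that by (intro prod.neutral) (auto simp: R_def gS_def)
  then have "real (card R) = (\<Sum>t\<in>R. \<Prod>l'\<in>L'. gS t l' (a l'))"
    by simp
  also have "\<dots> \<le> (\<Sum>t\<in>X l. \<Prod>l'\<in>L'. gS t l' (a l'))"
    using finX gS_nonneg by (intro sum_mono2) (auto simp: R_def)
  also have "\<dots> < q"
    using small sum_nonneg[of "X l" "\<lambda>t. real q * 2 ^ q * (\<Prod>l'\<in>L'. gR t l' (a l'))"] gR_nonneg
    by (smt (verit) mult_nonneg_nonneg of_nat_0_le_iff zero_le_power)
  finally have cardR: "card R < q" by simp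
  have cardS: "q \<le> card (S t)" if t: "t \<in> X l" for t
  proof (rule ccontr)
    assume "\<not> q \<le> card (S t)"
    then have "(1 / 2 :: real) ^ q \<le> (1 / 2) ^ card (S t)" by (intro power_decreasing) auto
    also have "\<dots> = (\<Prod>l'\<in>L'. gR t l' (a l'))"
      unfolding S_def gR_def using L' by (simp add: prod.inter_filter[symmetric])
    finally have "real q * 2 ^ q * (1 / 2) ^ q \<le> real q * 2 ^ q * (\<Prod>l'\<in>L'. gR t l' (a l'))"
      by (intro mult_left_mono) auto
    then have "real q \<le> real q * 2 ^ q * (\<Prod>l'\<in>L'. gR t l' (a l'))"
      by (simp add: power_divide)
    also have "\<dots> \<le> (\<Sum>t\<in>X l. real q * 2 ^ q * (\<Prod>l'\<in>L'. gR t l' (a l')))"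
      using t finX gR_nonneg by (intro member_le_sum) auto
    also have "\<dots> < q"
      using small sum_nonneg[of "X l" "\<lambda>t. \<Prod>l'\<in>L'. gS t l' (a l')"] gS_nonneg by force
    finally show False by simp
  qed
  have "\<exists>\<phi>. inj_on \<phi> R \<and> (\<forall>t\<in>R. \<phi> t \<in> S t)"
  proof (rule distinct_representatives[OF finR])
    fix t assume "t \<in> R"
    then show "card R \<le> card (S t)" using cardR cardS[of t] by (auto simp: R_def)
  qed
  then obtain \<phi> where \<phi>: "inj_on \<phi> R" "\<And>t. t \<in> R \<Longrightarrow> \<phi> t \<in> S t" by blast
  have "\<exists>s<M. t + s \<in> F (\<phi> t)" if t: "t \<in> R" for t
  proof -
    obtain u where "u \<in> F (\<phi> t)" "t \<le> u" "u < t + M"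
      using \<phi>(2)[OF t] by (auto simp: S_def window_def)
    then show ?thesis by (intro exI[of _ "u - t"]) auto
  qed
  then obtain \<beta> where \<beta>: "\<And>t. t \<in> R \<Longrightarrow> \<beta> t < M \<and> t + \<beta> t \<in> F (\<phi> t)" by metis
  \<comment> \<open>Representatives are reserved labels, so moving them to block survivors disturbs
    no label already placed. Reserved labels left over get the arbitrary position 0.\<close>
  define \<sigma> where "\<sigma> l' = (if l' \<in> \<phi> ` R then \<beta> (inv_into R \<phi> l') else if a l' < M then a l' else 0)" for l'
  have "\<sigma> l' < M" for l'
    using M \<beta> by (auto simp: \<sigma>_def inv_into_into)
  moreover have "\<exists>l'\<in>L - {l}. t + \<sigma> l' \<in> F l'" if t: "t \<in> F l" "t \<le> T" for t
  proof (cases "t \<in> R")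
    case True
    then have "\<sigma> (\<phi> t) = \<beta> t" using \<phi>(1) by (simp add: \<sigma>_def)
    then show ?thesis using True \<beta>[of t] \<phi>(2)[of t]
      by (intro bexI[of _ "\<phi> t"]) (auto simp: S_def L'_def)
  next
    case False
    then obtain l' where l': "l' \<in> L'" "a l' < M" "t + a l' \<in> F l'"
      using t by (auto simp: R_def X_def)
    then have "l' \<notin> \<phi> ` R" using \<phi>(2) by (force simp: S_def)
    then show ?thesis using l' by (auto simp: \<sigma>_def L'_def)
  qed
  ultimately show ?thesis using l by blast
qed

section \<open>Rumor propagation in caterpillars\<close>

text \<open>The all-\<open>None\<close> list is the history of any leaf. \<open>Forward\<close> can
  be ignored here, since after silence it transmits nothing.\<close>

definition leaf_fires :: "protocol \<Rightarrow> nat \<Rightarrow> nat \<Rightarrow> nat set" where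
  "leaf_fires P n l = {t. P n l t (replicate t None) = Fire}"

text \<open>The spine is \<open>0, ..., M - 1\<close> with root 0. Positions are counted from the
  far end \<open>M - 1\<close>, so that \<open>\<sigma> v\<close> is also the delay after which the
  victim's rumor arrives where leaf \<open>v\<close> is attached.\<close>

definition caterpillar :: "nat \<Rightarrow> (nat \<Rightarrow> nat) \<Rightarrow> nat \<Rightarrow> nat" where
  "caterpillar M \<sigma> v = (if v < M then v - 1 else M - 1 - \<sigma> v)"

lemma reception_eq_Some_iff:
  "reception C tx = Some x \<longleftrightarrow>
     (\<exists>w\<in>C. tx w = Some x \<and> (\<forall>w'\<in>C. tx w' \<noteq> None \<longrightarrow> w' = w))"
proof
  assume r: "reception C tx = Some x"
  let ?w = "THE w. w \<in> C \<and> tx w \<noteq> None"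
  have ex: "\<exists>!w. w \<in> C \<and> tx w \<noteq> None"
    using r unfolding reception_def by (metis option.distinct(1))
  then have "tx ?w = Some x" using r unfolding reception_def by metis
  then show "\<exists>w\<in>C. tx w = Some x \<and> (\<forall>w'\<in>C. tx w' \<noteq> None \<longrightarrow> w' = w)"
    using theI'[OF ex] ex by blast
next
  assume "\<exists>w\<in>C. tx w = Some x \<and> (\<forall>w'\<in>C. tx w' \<noteq> None \<longrightarrow> w' = w)"
  then obtain w where w: "w \<in> C" "tx w = Some x" and uniq: "\<forall>w'\<in>C. tx w' \<noteq> None \<longrightarrow> w' = w"
    by blast
  have ex: "\<exists>!w. w \<in> C \<and> tx w \<noteq> None" using w uniq by (metis option.distinct(1))
  then have "(THE w. w \<in> C \<and> tx w \<noteq> None) = w"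
    by (rule the1_equality) (simp add: w)
  then show "reception C tx = Some x" using ex w unfolding reception_def by metis
qed

lemma rooted_tree_caterpillar:
  assumes "0 < M" "M \<le> n"
  shows "rooted_tree n 0 (caterpillar M \<sigma>)"
proof -
  have spine: "(caterpillar M \<sigma> ^^ v) v = 0" if "v < M" for v
    using that
  proof (induction v)
    case (Suc v)
    then show ?case by (simp add: funpow_Suc_right caterpillar_def del: funpow.simps)
  qed simp
  have "\<exists>k. (caterpillar M \<sigma> ^^ k) v = 0" for v
  proof (cases "v < M")
    case False
    let ?u = "caterpillar M \<sigma> v"
    have "?u < M" using False assms by (auto simp: caterpillar_def)
    then have "(caterpillar M \<sigma> ^^ Suc ?u) v = 0"
      using spine by (simp add: funpow_Suc_right del: funpow.simps)
    then show ?thesis by blast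
  qed (use spine in blast)
  moreover have "caterpillar M \<sigma> v < n" if "v < n" for v
    using that assms by (auto simp: caterpillar_def)
  ultimately show ?thesis using assms unfolding rooted_tree_def by simp
qed

lemma history_leaf:
  assumes "children n r par u = {}"
  shows "history P n r par lab t u = replicate t None"
proof (induction t)
  case (Suc t)
  have "reception {} tx = None" for tx
    by (auto simp: reception_def)
  then show ?case by (simp add: Suc assms replicate_append_same)
qed simp

lemma transmission_replicate_None:
  "transmission P n l t (replicate t None) = (if t \<in> leaf_fires P n l then Some l else None)"
  by (auto simp: transmission_def previous_def leaf_fires_def split: action.split)

text \<open>Induction along the spine, starting at the far end. Node \<open>i\<close> gets the rumor
  either from the victim itself, which forces \<open>i = M - 1\<close>, or from spine node
  \<open>Suc i\<close>, which received it one step earlier. In both cases a leaf of \<open>i\<close>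
  firing at that step would collide.\<close>

lemma received_caterpillar:
  assumes "0 < M" "M \<le> l" "l < n" "\<And>v. \<sigma> v < M" "\<sigma> l = 0"
    and "received P n 0 (caterpillar M \<sigma>) id \<tau> i = Some l" "i < M"
  shows "\<exists>t. \<tau> = t + (M - 1 - i) \<and> t \<in> leaf_fires P n l \<and>
    (\<forall>l'\<in>{M..<n} - {l}. \<sigma> l' \<le> M - 1 - i \<longrightarrow> t + \<sigma> l' \<notin> leaf_fires P n l')"
  using assms(6,7)
proof (induction "M - 1 - i" arbitrary: i \<tau> rule: less_induct)
  case less
  let ?par = "caterpillar M \<sigma>"
  define tx where "tx = (\<lambda>w. transmission P n w \<tau> (history P n 0 ?par id \<tau> w))"
  have ch: "w \<in> children n 0 ?par i \<longleftrightarrow>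
      w = Suc i \<and> w < M \<and> w < n \<or> M \<le> w \<and> w < n \<and> i = M - 1 - \<sigma> w" for w
    using assms(1,2) by (auto simp: children_def caterpillar_def split: if_splits)
  have leaf: "tx w = (if \<tau> \<in> leaf_fires P n w then Some w else None)" if "M \<le> w" for w
  proof -
    have "children n 0 ?par w = {}"
      using that assms(1) by (auto simp: children_def caterpillar_def)
    then show ?thesis by (simp add: tx_def history_leaf transmission_replicate_None)
  qed
  have "reception (children n 0 ?par i) tx = Some l"
    using less.prems(1) by (simp add: received_def tx_def)
  then obtain w where w: "w \<in> children n 0 ?par i" "tx w = Some l"
    and uniq: "\<And>w'. w' \<in> children n 0 ?par i \<Longrightarrow> tx w' \<noteq> None \<Longrightarrow> w' = w"
    unfolding reception_eq_Some_iff by blast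
  show ?case
  proof (cases "w < M")
    case False
    then have [simp]: "w = l" and fire: "\<tau> \<in> leaf_fires P n l"
      using w(2) leaf[of w] by (auto split: if_splits)
    have i: "i = M - 1" using w(1) False assms(2,5) by (auto simp: ch)
    have "\<tau> + \<sigma> l' \<notin> leaf_fires P n l'" if l': "l' \<in> {M..<n} - {l}" "\<sigma> l' \<le> M - 1 - i" for l'
    proof
      assume "\<tau> + \<sigma> l' \<in> leaf_fires P n l'"
      then have "tx l' \<noteq> None" using l' leaf[of l'] i by auto
      moreover have "l' \<in> children n 0 ?par i" unfolding ch using l' i by auto
      ultimately show False using uniq[of l'] l' by auto
    qed
    then show ?thesis using fire i by auto
  next
    case True
    then have [simp]: "w = Suc i" and i: "Suc i < M" using w(1) by (auto simp: ch)
    \<comment> \<open>Labels are the identity and \<open>Suc i < M \<le> l\<close>, so the spine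
      node cannot have fired \<open>l\<close> as its own rumor; it must have forwarded it.\<close>
    have prev: "previous (history P n 0 ?par id \<tau> (Suc i)) = Some l"
      using w(2) True assms(2) unfolding tx_def transmission_def
      by (auto split: action.splits if_splits)
    then obtain \<tau>' where \<tau>': "\<tau> = Suc \<tau>'"
      by (cases \<tau>) (auto simp: previous_def)
    then have "received P n 0 ?par id \<tau>' (Suc i) = Some l"
      using prev by (simp add: previous_def received_def)
    then obtain t where t: "\<tau>' = t + (M - 1 - Suc i)" "t \<in> leaf_fires P n l"
      and un: "\<And>l'. l' \<in> {M..<n} - {l} \<Longrightarrow> \<sigma> l' \<le> M - 1 - Suc i \<Longrightarrow> t + \<sigma> l' \<notin> leaf_fires P n l'"
      using less.hyps[OF _ _ i, of \<tau>'] i by (metis One_nat_def diff_less_mono2 lessI less_diff_conv plus_1_eq_Suc add.commute)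
    have \<tau>: "\<tau> = t + (M - 1 - i)" using t(1) \<tau>' i by simp
    have "t + \<sigma> l' \<notin> leaf_fires P n l'" if l': "l' \<in> {M..<n} - {l}" "\<sigma> l' \<le> M - 1 - i" for l'
    proof (cases "\<sigma> l' = M - 1 - i")
      case True
      then have ii: "i = M - 1 - \<sigma> l'" using i by simp
      show ?thesis
      proof
        assume "t + \<sigma> l' \<in> leaf_fires P n l'"
        then have "tx l' \<noteq> None" using l' leaf[of l'] \<tau> True by auto
        moreover have "l' \<in> children n 0 ?par i" unfolding ch using l' ii by auto
        ultimately have "l' = Suc i" using uniq[of l'] by auto
        then show False using l' i by auto
      qed
    qed (use un l' in auto)
    then show ?thesis using \<tau> t(2) by blast
  qed
qed

section \<open>Choice of parameters and the final bound\<close>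

text \<open>Supplies the hypothesis \<open>qT\<close>, since \<open>T\<close> is below the cube of
  \<open>sqrt n\<close>. The base case 16 is an equality.\<close>

lemma power4_le_two_power: "n \<ge> 16 \<Longrightarrow> n ^ 4 \<le> (2 :: nat) ^ n"
proof (induction n rule: nat_induct_at_least)
  case (Suc n)
  have "Suc n ^ 4 = n ^ 4 + 4 * n ^ 3 + 6 * n ^ 2 + 4 * n + 1"
    by (simp add: power4_eq_xxxx power3_eq_cube power2_eq_square algebra_simps)
  also have "\<dots> \<le> n ^ 4 + 4 * n ^ 3 + 6 * n ^ 3 + 4 * n ^ 3 + n ^ 3"
  proof -
    have "n ^ 2 \<le> n ^ 3" "n ^ 1 \<le> n ^ 3" "n ^ 0 \<le> n ^ 3"
      using Suc.hyps by (intro power_increasing; simp)+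
    then show ?thesis by simp
  qed
  also have "\<dots> \<le> n ^ 4 + 16 * n ^ 3" by simp
  also have "\<dots> \<le> n ^ 4 + n * n ^ 3" using Suc.hyps by (intro add_left_mono mult_right_mono) auto
  also have "\<dots> = 2 * n ^ 4" by (simp add: power4_eq_xxxx power3_eq_cube)
  also have "\<dots> \<le> 2 ^ Suc n" using Suc.IH by simp
  finally show ?case .
qed simp

text \<open>With half of the nodes on the spine and \<open>q\<close> about
  \<open>s = sqrt n\<close>, a run shorter than \<open>s ^ 3 / 1000\<close> has at most
  \<open>7 * s / 500\<close> blocks. Each block accounts for at most \<open>10 * s\<close> bad
  labels, in total less than the roughly \<open>n / 2\<close> leaf labels.\<close>

lemma running_time_ge:
  assumes P: "gathering_protocol P" and n: "n \<ge> 10000"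
  shows "real n powr (3/2) / 1000 \<le> running_time P n"
proof (rule ccontr)
  define T where "T = running_time P n"
  define s where "s = sqrt n"
  define q where "q = nat \<lceil>s\<rceil>"
  define M where "M = n div 2"
  assume less: "\<not> real n powr (3/2) / 1000 \<le> running_time P n"
  have ns: "real n = s * s" by (simp add: s_def)
  have s: "s \<ge> 100" unfolding s_def using n by (intro real_le_rsqrt) simp
  have "real n powr (3/2) = (s powr 2) powr (3/2)"
    using s by (simp add: ns power2_eq_square)
  also have "\<dots> = s powr 3" by (simp only: powr_powr) simp
  also have "\<dots> = s ^ 3" using s by simp
  finally have T: "real T < s ^ 3 / 1000" using less by (simp add: T_def)
  have q: "s \<le> q" "q \<le> s + 1" using s unfolding q_def by linarith+
  have M: "M > 0" "M \<le> n" "real M \<le> s * s / 2" "real M \<ge> s * s / 4"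
    using n unfolding M_def ns[symmetric] by linarith+
  \<comment> \<open>The additional block is absorbed by \<open>1 \<le> s / 100\<close>.\<close>
  have K: "real (T div M + 1) \<le> 7 * s / 500"
  proof -
    have "real (T div M) \<le> real T / real M" by (rule of_nat_div_le_of_nat)
    also have "\<dots> \<le> (s ^ 3 / 1000) / (s * s / 4)"
      using T M s by (intro frac_le) auto
    also have "\<dots> = s / 250" using s by (simp add: power3_eq_cube)
    finally show ?thesis using s by simp
  qed
  have "5 * real q + 8 * real M / real q \<le> 10 * s"
  proof -
    have "8 * real M / q \<le> 8 * (s * s / 2) / s"
      using M q s by (intro frac_le) auto
    also have "\<dots> = 4 * s" using s by simp
    finally show ?thesis using q s by simp
  qed
  then have "real (T div M + 1) * (5 * real q + 8 * real M / real q) \<le> (7 * s / 500) * (10 * s)"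
    using K s by (intro mult_mono) auto
  also have "\<dots> < s * s / 2" using s by simp
  also have "\<dots> \<le> card {M..<n}" using M ns by (simp add: of_nat_diff)
  finally have count: "real (T div M + 1) * (5 * real q + 8 * real M / real q) < card {M..<n}" .
  have "2 * (real T + 1) \<le> s ^ 3 / 500 + 2" using T by simp
  also have "\<dots> \<le> s ^ 3" using power_increasing[of 1 3 s] s by simp
  also have "\<dots> \<le> s ^ 4" using s by (intro power_increasing) auto
  also have "\<dots> \<le> real q ^ 4" using q s by (intro power_mono) auto
  also have "\<dots> \<le> 2 ^ q"
  proof -
    have "16 \<le> q" using q s by linarith
    then have "real (q ^ 4) \<le> real (2 ^ q)"
      using power4_le_two_power by (intro of_nat_mono)
    then show ?thesis by simp
  qed
  finally have qT: "2 * (real T + 1) \<le> 2 ^ q" .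
  have "q > 0" using q s by linarith
  then obtain l \<sigma> where l: "l \<in> {M..<n}" and \<sigma>: "\<And>v. \<sigma> v < M"
    and blocked: "\<And>t. t \<in> leaf_fires P n l \<Longrightarrow> t \<le> T \<Longrightarrow>
      \<exists>l'\<in>{M..<n} - {l}. t + \<sigma> l' \<in> leaf_fires P n l'"
    using exists_blocked_label[OF finite_atLeastLessThan M(1) _ qT count, of "leaf_fires P n"] by blast
  \<comment> \<open>The victim has to hang at the far end; \<open>blocked\<close> involves only
    positions of other labels, so the change preserves it.\<close>
  define \<sigma>' where "\<sigma>' = \<sigma>(l := 0)"
  have completes: "completes_by P n T"
    unfolding T_def using P by (rule completes_by_running_time)
  have \<sigma>': "\<sigma>' v < M" "\<sigma>' l = 0" for v using \<sigma> M(1) by (auto simp: \<sigma>'_def)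
  have "delivered_by P n 0 (caterpillar M \<sigma>') id l T"
    using completes l rooted_tree_caterpillar[OF M(1,2)] unfolding completes_by_def labeling_def by auto
  then obtain \<tau> where \<tau>: "\<tau> \<le> T" "received P n 0 (caterpillar M \<sigma>') id \<tau> 0 = Some l"
    using l M by (auto simp: delivered_by_def)
  obtain t where t: "\<tau> = t + (M - 1)" "t \<in> leaf_fires P n l"
    and free: "\<And>l'. l' \<in> {M..<n} - {l} \<Longrightarrow> \<sigma>' l' \<le> M - 1 \<Longrightarrow> t + \<sigma>' l' \<notin> leaf_fires P n l'"
    using received_caterpillar[OF M(1) _ _ \<sigma>' \<tau>(2) M(1)] l by (metis atLeastLessThan_iff diff_zero)
  have "t \<le> T" using t(1) \<tau>(1) by simp
  then obtain l' where "l' \<in> {M..<n} - {l}" "t + \<sigma> l' \<in> leaf_fires P n l'"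
    using blocked[OF t(2)] by blast
  moreover have "\<sigma> l' \<le> M - 1" using \<sigma>[of l'] by linarith
  ultimately show False using free[of l'] by (simp add: \<sigma>'_def)
qed

theorem theorem5:
  fixes P :: protocol
  assumes "gathering_protocol P"
  shows "(\<lambda>n. real (running_time P n)) \<in> \<Omega>(\<lambda>n. real n powr (3/2))"
proof (rule landau_omega.bigI)
  show "eventually (\<lambda>n. norm (real (running_time P n)) \<ge> 1/1000 * norm (real n powr (3/2))) sequentially"
    using eventually_ge_at_top[of 10000]
    by eventually_elim (use running_time_ge[OF assms] in auto)
qed simp

end
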